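(* Let $E$ be a Banach space, and let $M$ and $N$ be two closed vector subspaces of $E$. Then the following two conditions are equivalent. (i) $M+N$ is closed in $E$. (ii) There exists $c > 0$ such that for every $z \in M+N$ there exists $(x,y) \in M \times N$ with $x+y = z$ and $\Vert x \Vert \leq c\, \Vert z \Vert$.
   Context: $M+N = \{x+y : x \in M,\ y \in N\}$. *)

theory Defs
  imports "HOL-Analysis.Analysis" "HOL-Library.Set_Algebras"
begin

end

theory Submission
  imports Defs
begin

text \<open>
  Both implications rest on the iteration from the proof of the open mapping theorem: if every \<open>z\<close>
  in a set \<open>T\<close> that is stable under subtracting elements of \<open>M + N\<close> can be approximated up to
  \<open>\<parallel>z\<parallel> / 2\<close> by some \<open>x + y\<close> with \<open>x \<in> M\<close>, \<open>y \<in> N\<close> and \<open>\<parallel>x\<parallel> \<le> c \<parallel>z\<parallel>\<close>, then successive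
  approximation of the remainders yields an exact decomposition with constant \<open>2 c\<close>. If \<open>M + N\<close>
  is closed, it is itself a Banach space, and Baire's theorem provides the approximations for
  \<open>T = M + N\<close>. Conversely, the bounded decompositions on \<open>M + N\<close> provide the
  approximations for \<open>T = closure (M + N)\<close>, whence \<open>closure (M + N) \<subseteq> M + N\<close>.
\<close>

lemma subspace_set_plus:
  fixes M N :: "'a::real_vector set"
  assumes "subspace M" and "subspace N"
  shows "subspace (M + N)"
proof -
  have "M + N = {x + y |x y. x \<in> M \<and> y \<in> N}"
    by (auto simp: set_plus_def)
  then show ?thesis
    using subspace_sums[OF assms] by simp
qed

text \<open>The remainders \<open>r n\<close> at least halve in norm at each step, so the
  corrections \<open>X (r n)\<close> are dominated by a geometric series with sum
  \<open>2 * c * norm z\<close>. Completeness gives their sum \<open>x\<close>, and closedness of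
  \<open>M\<close> and \<open>N\<close> keeps both limits in place.\<close>

lemma decomposition_from_approximation:
  fixes M N T :: "'a::banach set"
  assumes M: "subspace M" "closed M" and N: "subspace N" "closed N"
    and T: "\<And>z w. z \<in> T \<Longrightarrow> w \<in> M + N \<Longrightarrow> z - w \<in> T"
    and approx: "\<And>z. z \<in> T \<Longrightarrow> \<exists>x\<in>M. \<exists>y\<in>N. norm x \<le> c * norm z \<and> norm (z - (x + y)) \<le> norm z / 2"
    and c: "0 \<le> c" and z: "z \<in> T"
  obtains x y where "x \<in> M" "y \<in> N" "x + y = z" "norm x \<le> 2 * c * norm z"
proof -
  from approx obtain X Y where XY: "\<And>z. z \<in> T \<Longrightarrow> X z \<in> M" "\<And>z. z \<in> T \<Longrightarrow> Y z \<in> N"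
    "\<And>z. z \<in> T \<Longrightarrow> norm (X z) \<le> c * norm z"
    "\<And>z. z \<in> T \<Longrightarrow> norm (z - (X z + Y z)) \<le> norm z / 2"
    by metis
  define r where "r n = ((\<lambda>z. z - (X z + Y z)) ^^ n) z" for n
  have r_0: "r 0 = z" and r_Suc: "r (Suc n) = r n - (X (r n) + Y (r n))" for n
    by (simp_all add: r_def)
  have r_T: "r n \<in> T" for n
    by (induction n) (auto simp: r_0 r_Suc z intro!: T XY)
  have r_norm: "norm (r n) \<le> norm z * (1/2) ^ n" for n
  proof (induction n)
    case (Suc n)
    have "norm (r (Suc n)) \<le> norm (r n) / 2"
      unfolding r_Suc by (rule XY(4)[OF r_T])
    with Suc show ?case by simp
  qed (simp add: r_0)
  have X_norm: "norm (X (r n)) \<le> c * norm z * (1/2) ^ n" for n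
    using order_trans[OF XY(3)[OF r_T] mult_left_mono[OF r_norm c]] by (simp add: mult.assoc)
  have bound_sums: "(\<lambda>n. c * norm z * (1/2) ^ n) sums (2 * c * norm z)"
    using sums_mult[OF geometric_sums[of "1/2::real"], of "c * norm z"] by (simp add: mult_ac)
  have summable_norm_X: "summable (\<lambda>n. norm (X (r n)))"
    by (rule summable_comparison_test'[OF sums_summable[OF bound_sums]]) (simp add: X_norm)
  define x where "x = (\<Sum>n. X (r n))"
  have x_lim: "(\<lambda>n. \<Sum>k<n. X (r k)) \<longlonglongrightarrow> x"
    unfolding x_def by (rule summable_LIMSEQ[OF summable_norm_cancel[OF summable_norm_X]])
  have x_M: "x \<in> M"
    by (rule closed_sequentially[OF M(2) _ x_lim]) (auto intro!: subspace_sum M XY r_T)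
  \<comment> \<open>The terms \<open>Y (r k)\<close> carry no norm bound of their own; their partial
    sums converge because this identity expresses them through \<open>r n\<close> and the
    \<open>X\<close> sums.\<close>
  have telescope: "(\<Sum>k<n. Y (r k)) = z - r n - (\<Sum>k<n. X (r k))" for n
    by (induction n) (auto simp: r_0 r_Suc)
  have "(\<lambda>n. norm z * (1/2) ^ n) \<longlonglongrightarrow> 0"
    by (intro tendsto_mult_right_zero LIMSEQ_power_zero) simp
  then have r_lim: "r \<longlonglongrightarrow> 0"
    by (rule Lim_null_comparison[rotated]) (simp add: r_norm)
  have y_lim: "(\<lambda>n. \<Sum>k<n. Y (r k)) \<longlonglongrightarrow> z - 0 - x"
    unfolding telescope by (intro tendsto_intros r_lim x_lim)
  have "z - 0 - x \<in> N"
    by (rule closed_sequentially[OF N(2) _ y_lim]) (auto intro!: subspace_sum N XY r_T)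
  then have y_N: "z - x \<in> N"
    by simp
  have "norm x \<le> (\<Sum>n. norm (X (r n)))"
    unfolding x_def by (rule summable_norm[OF summable_norm_X])
  also have "\<dots> \<le> 2 * c * norm z"
    using suminf_le[OF X_norm summable_norm_X sums_summable[OF bound_sums]] sums_unique[OF bound_sums]
    by simp
  finally show ?thesis
    using that[OF x_M y_N] by simp
qed

text \<open>The sets \<open>K n\<close>, which bound only the \<open>M\<close>-component, exhaust
  \<open>M + N\<close>. By Baire the closure of one of them contains a relative ball; recentring it
  at 0 and rescaling gives the estimate for all \<open>z\<close>.\<close>

lemma approximation_if_closed_sum:
  fixes M N :: "'a::banach set"
  assumes M: "subspace M" and N: "subspace N" and clo: "closed (M + N)"
  obtains c where "c > 0" "\<And>z. z \<in> M + N \<Longrightarrow>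
    \<exists>x\<in>M. \<exists>y\<in>N. norm x \<le> c * norm z \<and> norm (z - (x + y)) \<le> norm z / 2"
proof -
  define S where "S = M + N"
  define K where "K n = {x + y |x y. x \<in> M \<and> y \<in> N \<and> norm x \<le> real n}" for n :: nat
  have S: "subspace S"
    unfolding S_def by (rule subspace_set_plus[OF M N])
  have K_S: "K n \<subseteq> S" for n
    by (auto simp: K_def S_def)
  \<comment> \<open>The closures are taken in the whole space; they stay inside \<open>S\<close>
    because \<open>S\<close> is closed.\<close>
  have Un: "\<Union>(range (\<lambda>n. closure (K n))) = S"
  proof
    show "\<Union>(range (\<lambda>n. closure (K n))) \<subseteq> S"
      using closure_minimal[OF K_S] clo by (auto simp: S_def)
    show "S \<subseteq> \<Union>(range (\<lambda>n. closure (K n)))"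
    proof
      fix u assume "u \<in> S"
      then obtain x y where xy: "x \<in> M" "y \<in> N" "u = x + y"
        by (auto simp: S_def elim!: set_plus_elim)
      obtain n where "norm x \<le> real n"
        using real_arch_simple by blast
      with xy have "u \<in> K n" by (auto simp: K_def)
      then show "u \<in> \<Union>(range (\<lambda>n. closure (K n)))"
        using closure_subset by fastforce
    qed
  qed
  have compl: "completely_metrizable_space (top_of_set S)"
    using clo completely_metrizable_space_closedin completely_metrizable_space_euclidean
    by (metis S_def closed_closedin)
  have "\<exists>n. top_of_set S interior_of closure (K n) \<noteq> {}"
  proof (rule ccontr)
    assume "\<not> ?thesis"
    moreover have "closedin (top_of_set S) (closure (K n))" for n
      using Un by (intro closed_subset) auto
    ultimately have "top_of_set S interior_of \<Union>(range (\<lambda>n. closure (K n))) = {}"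
      by (intro Baire_category_alt) (auto simp: compl)
    then show False
      unfolding Un using subspace_0[OF S] interior_of_topspace[of "top_of_set S"] by auto
  qed
  then obtain n z0 where "z0 \<in> top_of_set S interior_of closure (K n)"
    by blast
  then obtain U where U: "openin (top_of_set S) U" "z0 \<in> U" "U \<subseteq> closure (K n)"
    by (auto simp: interior_of_def)
  then obtain e where z0: "z0 \<in> S" and e: "e > 0" "\<And>u. u \<in> S \<Longrightarrow> dist u z0 < e \<Longrightarrow> u \<in> closure (K n)"
    by (auto simp: openin_euclidean_subtopology_iff subset_iff)
  \<comment> \<open>Subtracting an approximation of \<open>z0\<close> from one of
    \<open>z0 + w\<close> moves the ball to the origin: the bound \<open>n\<close> doubles, and two
    errors below \<open>e / 8\<close> add up to at most \<open>e / 4\<close>.\<close>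
  have near: "\<exists>x\<in>M. \<exists>y\<in>N. norm x \<le> 2 * real n \<and> norm (w - (x + y)) \<le> e / 4"
    if w: "w \<in> S" "norm w < e" for w
  proof -
    have "z0 + w \<in> closure (K n)" "z0 \<in> closure (K n)"
      using e w z0 by (auto simp: dist_norm intro!: subspace_add S e(2))
    then obtain p q where p: "p \<in> K n" "dist p (z0 + w) < e / 8" and q: "q \<in> K n" "dist q z0 < e / 8"
      using e(1) unfolding closure_approachable by (meson zero_less_divide_iff zero_less_numeral)
    from p(1) q(1) obtain a b a' b' where ab: "p = a + b" "q = a' + b'" "a \<in> M" "a' \<in> M" "b \<in> N" "b' \<in> N"
      "norm a \<le> real n" "norm a' \<le> real n"
      by (auto simp: K_def)
    have "w - ((a - a') + (b - b')) = (q - z0) - (p - (z0 + w))"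
      by (simp add: ab)
    also have "norm \<dots> \<le> e / 4"
      using norm_triangle_ineq4[of "q - z0" "p - (z0 + w)"] p(2) q(2) by (simp add: dist_norm)
    finally have "norm (w - ((a - a') + (b - b'))) \<le> e / 4" .
    moreover have "norm (a - a') \<le> 2 * real n"
      using norm_triangle_ineq4[of a a'] ab by simp
    ultimately show ?thesis
      using ab subspace_diff[OF M] subspace_diff[OF N] by blast
  qed
  \<comment> \<open>The factor \<open>4 * real n / e\<close> is the bound \<open>2 * real n\<close>
    rescaled by \<open>t\<close> below; the summand 1 ensures positivity even if
    \<open>n = 0\<close>.\<close>
  define c where "c = 4 * real n / e + 1"
  have "\<exists>x\<in>M. \<exists>y\<in>N. norm x \<le> c * norm z \<and> norm (z - (x + y)) \<le> norm z / 2"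
    if z: "z \<in> S" for z
  proof (cases "z = 0")
    case True
    then show ?thesis
      using subspace_0[OF M] subspace_0[OF N] by (intro bexI[of _ 0]) auto
  next
    case False
    \<comment> \<open>Dividing by \<open>t\<close> brings \<open>z\<close> to norm
      \<open>e / 2\<close>, inside the ball; scaling back turns the error \<open>e / 4\<close> into
      \<open>norm z / 2\<close>.\<close>
    define t where "t = 2 * norm z / e"
    have t: "t > 0" using False e(1) by (simp add: t_def)
    have "norm (inverse t *\<^sub>R z) < e"
      using False e(1) by (simp add: t_def)
    then obtain x y where xy: "x \<in> M" "y \<in> N" "norm x \<le> 2 * real n"
      "norm (inverse t *\<^sub>R z - (x + y)) \<le> e / 4"
      using near[OF subspace_scale[OF S z]] by blast
    have "norm (t *\<^sub>R x) \<le> t * (2 * real n)"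
      using xy t by simp
    also have "\<dots> \<le> c * norm z"
      by (simp add: t_def c_def field_simps)
    finally have 1: "norm (t *\<^sub>R x) \<le> c * norm z" .
    have "z - (t *\<^sub>R x + t *\<^sub>R y) = t *\<^sub>R (inverse t *\<^sub>R z - (x + y))"
      using t by (simp add: algebra_simps)
    also have "norm \<dots> \<le> t * (e / 4)"
      using xy(4) t by simp
    also have "\<dots> = norm z / 2"
      using e(1) by (simp add: t_def)
    finally show ?thesis
      using 1 subspace_scale[OF M xy(1)] subspace_scale[OF N xy(2)] by blast
  qed
  moreover have "c > 0"
    using e(1) by (simp add: c_def add_nonneg_pos)
  ultimately show ?thesis
    using that unfolding S_def by blast
qed

theorem theorem3p1:
  fixes M N :: "'a::banach set"
  assumes "subspace M" and "closed M"
    and "subspace N" and "closed N"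
  shows "closed (M + N) \<longleftrightarrow>
    (\<exists>c>0. \<forall>z\<in>M + N. \<exists>(x, y)\<in>M \<times> N. x + y = z \<and> norm x \<le> c * norm z)"
proof
  have subspace: "subspace (M + N)"
    by (rule subspace_set_plus[OF assms(1,3)])
  {
    assume "closed (M + N)"
    then obtain c where c: "c > 0" and approx: "\<And>z. z \<in> M + N \<Longrightarrow>
        \<exists>x\<in>M. \<exists>y\<in>N. norm x \<le> c * norm z \<and> norm (z - (x + y)) \<le> norm z / 2"
      using approximation_if_closed_sum assms by metis
    have "\<exists>(x, y)\<in>M \<times> N. x + y = z \<and> norm x \<le> 2 * c * norm z" if z: "z \<in> M + N" for z
    proof -
      obtain x y where "x \<in> M" "y \<in> N" "x + y = z" "norm x \<le> 2 * c * norm z"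
        by (rule decomposition_from_approximation[OF assms subspace_diff[OF subspace] approx less_imp_le[OF c] z])
      then show ?thesis by blast
    qed
    then show "\<exists>c>0. \<forall>z\<in>M + N. \<exists>(x, y)\<in>M \<times> N. x + y = z \<and> norm x \<le> c * norm z"
      using c by (intro exI[of _ "2 * c"]) auto
  next
    assume "\<exists>c>0. \<forall>z\<in>M + N. \<exists>(x, y)\<in>M \<times> N. x + y = z \<and> norm x \<le> c * norm z"
    then obtain c where c: "c > 0"
      and bounded: "\<And>z. z \<in> M + N \<Longrightarrow> \<exists>x\<in>M. \<exists>y\<in>N. x + y = z \<and> norm x \<le> c * norm z"
      by fastforce
    have closure_diff: "z - w \<in> closure (M + N)" if "z \<in> closure (M + N)" "w \<in> M + N" for z w
      unfolding closure_approachable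
    proof safe
      fix e :: real assume "e > 0"
      then obtain s where "s \<in> M + N" "dist s z < e"
        using \<open>z \<in> closure (M + N)\<close> unfolding closure_approachable by blast
      then show "\<exists>y\<in>M + N. dist y (z - w) < e"
        using subspace_diff[OF subspace _ \<open>w \<in> M + N\<close>] by (intro bexI[of _ "s - w"]) (auto simp: dist_norm)
    qed
    have approx: "\<exists>x\<in>M. \<exists>y\<in>N. norm x \<le> 2 * c * norm z \<and> norm (z - (x + y)) \<le> norm z / 2"
      if z: "z \<in> closure (M + N)" for z
    proof (cases "z = 0")
      case True
      then show ?thesis
        using subspace_0[OF assms(1)] subspace_0[OF assms(3)] by (intro bexI[of _ 0]) auto
    next
      case False
      \<comment> \<open>An exact bounded decomposition of a nearby \<open>s\<close> in
        \<open>M + N\<close> serves as the approximate one of \<open>z\<close>; the factor 2 in the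
        bound absorbs passing from \<open>norm s\<close> to \<open>norm z\<close>.\<close>
      then obtain s where s: "s \<in> M + N" "dist s z < norm z / 2"
        using z unfolding closure_approachable by (meson half_gt_zero zero_less_norm_iff)
      then obtain x y where xy: "x \<in> M" "y \<in> N" "x + y = s" "norm x \<le> c * norm s"
        using bounded by blast
      have "norm s \<le> 2 * norm z"
        using s(2) norm_triangle_ineq2[of s z] norm_ge_zero[of z] unfolding dist_norm by linarith
      then have "c * norm s \<le> 2 * c * norm z"
        using c by simp
      then show ?thesis
        using xy s(2) by (intro bexI[of _ x] bexI[of _ y]) (auto simp: dist_norm norm_minus_commute)
    qed
    have "closure (M + N) \<subseteq> M + N"
    proof
      fix z assume z: "z \<in> closure (M + N)"
      obtain x y where "x \<in> M" "y \<in> N" "x + y = z"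
        by (rule decomposition_from_approximation[OF assms closure_diff approx _ z]) (use c in auto)
      then show "z \<in> M + N" by blast
    qed
    then show "closed (M + N)"
      using closure_subset_eq by blast
  }
qed

end
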